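(* There exists a family of strings on which $\nu = o(\min(\ell,b))$. That is, there is an infinite set $\mathcal{F}'$ of strings such that $\nu(w)=o\big(\min(\ell(w),b(w))\big)$ for $w\in\mathcal{F}'$, as $|w|\to\infty$.
   Context: A string family is an infinite set of finite strings of unbounded length; asymptotic notation on a family refers to strings $w$ of the family with $n=|w|\to\infty$ (with constants uniform over the family). $w[i:j]$ denotes the substring of $w$ from position $i$ to position $j$ (positions start at 1), and $w[:j]=w[1:j]$. L-systems: an L-system is a tuple $(\Sigma,\varphi,\tau,s,d,n)$, where $\Sigma$ is a finite alphabet, $\varphi:\Sigma^*\to\Sigma^*$ is a non-erasing monoid endomorphism (each rule $a\to\varphi(a)$, $a\in\Sigma$, has $|\varphi(a)|\ge 1$), $\tau:\Sigma^*\to\Sigma^*$ is a coding (a morphism with $|\tau(a)|=1$ for all $a\in\Sigma$), $s\in\Sigma^+$ is the axiom, and $d\ge 0$, $n\ge 1$ are integers. It generates the unique string $\tau(\varphi^d(s))[1:n]$ of length $n$. It is always assumed that $d=n^{O(1)}$ and $|\Sigma|=n^{O(1)}$ (each value fits in an $O(\log n)$-bit word). The size of the L-system is $\sum_{a\in\Sigma}|\varphi(a)|+|s|+|\Sigma|+2$. The measure $\ell(w)$ is the size of the smallest L-system generating $w$. Macro-schemes: a bidirectional macro-scheme for $w$ is a factorization of $w$ into non-empty phrases where each phrase of length greater than 1 is assigned a copy (source occurrence in $w$) starting at a different position, and phrases of length 1 may be stored explicitly, so that $w$ can be recovered by following the induced position-to-position pointers (i.e. the pointers have no cycles). $b(w)$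 is the smallest number of phrases of a bidirectional macro-scheme for $w$. NU-systems: a NU-system is a tuple $(V,R,\tau,s,d,n)$ generating a unique string of length $n$ in the way an L-system does ($V$ the alphabet, $R$ the rules, one per symbol of $V$ with non-empty right-hand side, $\tau$ a coding, $s$ the axiom, $d$ the level, $n$ the prefix length), except that right-hand sides of rules and the axiom may also contain special extraction symbols $a(k)[i:j]$ with $a\in V$. The meaning of $a(k)[i:j]$ is: generate the $k$-th level starting from $a$, extract from it the substring from position $i$ to position $j$, and apply the coding $\tau$ to that substring. One step from a level to the next replaces each ordinary symbol by the right-hand side of its rule and each extraction symbol by the string it denotes; extraction symbols remaining in the level from which a string is extracted, or in the final level $d$, are likewise replaced by the strings they denote. The generated string is the length-$n$ prefix of the image under $\tau$ of the $d$-th level from $s$. The indexes inside a NU-system (levels, interval endpoints) must be at most $n$. The system must be free of loops: determining the symbols of the extracted substrings and of the output prefix must not lead to circular dependencies. The size of a NU-system is $\sum_{a\in V}|R(a)|+|s|+|V|+2$, where each extraction symbol counts as having length 4. $\nu(w)$ is the size of the smallest NU-system generating $w$. *)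

theory Defs
  imports Complex_Main "HOL-Library.Landau_Symbols"
begin

text \<open>
  Strings are lists over \<^typ>\<open>nat\<close>: every finite alphabet, including the auxiliary symbols
  of a system generating a given string, embeds into it.
\<close>

section \<open>String families\<close>

definition string_family :: "nat list set \<Rightarrow> bool" where
  "string_family F \<longleftrightarrow> infinite F \<and> (\<forall>N. \<exists>w\<in>F. N \<le> length w)"

definition along :: "nat list set \<Rightarrow> nat list filter" where
  "along F = inf (filtercomap length at_top) (principal F)"

text \<open>\<open>w[i:j]\<close>, with positions starting at 1.\<close>

definition substr :: "nat list \<Rightarrow> nat \<Rightarrow> nat \<Rightarrow> nat list" where
  "substr w i j = take (j + 1 - i) (drop (i - 1) w)"


section \<open>L-systems\<close>

record l_system =
  l_alphabet :: "nat set"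
  l_rule :: "nat \<Rightarrow> nat list"
  l_coding :: "nat \<Rightarrow> nat"
  l_start :: "nat list"
  l_depth :: nat
  l_length :: nat

definition morph :: "(nat \<Rightarrow> nat list) \<Rightarrow> nat list \<Rightarrow> nat list" where
  "morph f u = concat (map f u)"

definition is_l_system :: "l_system \<Rightarrow> bool" where
  "is_l_system L \<longleftrightarrow>
     finite (l_alphabet L) \<and>
     (\<forall>a\<in>l_alphabet L. l_rule L a \<noteq> [] \<and> set (l_rule L a) \<subseteq> l_alphabet L \<and>
        l_coding L a \<in> l_alphabet L) \<and>
     l_start L \<noteq> [] \<and> set (l_start L) \<subseteq> l_alphabet L \<and>
     1 \<le> l_length L"

definition l_generates :: "l_system \<Rightarrow> nat list \<Rightarrow> bool" where
  "l_generates L w \<longleftrightarrow>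
     length w = l_length L \<and>
     w = take (l_length L) (map (l_coding L) ((morph (l_rule L) ^^ l_depth L) (l_start L)))"

definition l_size :: "l_system \<Rightarrow> nat" where
  "l_size L = (\<Sum>a\<in>l_alphabet L. length (l_rule L a)) + length (l_start L)
     + card (l_alphabet L) + 2"

text \<open>
  The standing assumption that depth and alphabet size are \<open>n\<^bsup>O(1)\<^esup>\<close> has no meaning for a
  single string. The exponent \<open>c\<close> is therefore a parameter of the measure, to be quantified
  universally outside of asymptotic statements. For \<open>c \<ge> 1\<close> and \<open>w \<noteq> []\<close> a generating system
  exists (axiom \<open>w\<close>, depth 0).
\<close>

definition ell :: "nat \<Rightarrow> nat list \<Rightarrow> nat" where
  "ell c w = (LEAST m. \<exists>L. is_l_system L \<and> l_generates L w \<and>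
     l_depth L \<le> l_length L ^ c \<and> card (l_alphabet L) \<le> l_length L ^ c \<and> m = l_size L)"


section \<open>Bidirectional macro-schemes\<close>

text \<open>
  A scheme is the list of its phrases, each with the starting position of its source, or
  \<^const>\<open>None\<close> if the phrase is stored explicitly.
\<close>

type_synonym scheme = "(nat list \<times> nat option) list"

definition phrase_start :: "scheme \<Rightarrow> nat \<Rightarrow> nat" where
  "phrase_start M t = 1 + length (concat (map fst (take t M)))"

definition pointers :: "scheme \<Rightarrow> (nat \<times> nat) set" where
  "pointers M = {(phrase_start M t + r, q + r) | t q r.
     t < length M \<and> snd (M ! t) = Some q \<and> r < length (fst (M ! t))}"

definition macro_scheme :: "scheme \<Rightarrow> nat list \<Rightarrow> bool" where
  "macro_scheme M w \<longleftrightarrow>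
     concat (map fst M) = w \<and>
     (\<forall>t<length M. fst (M ! t) \<noteq> [] \<and>
        (case snd (M ! t) of
           None \<Rightarrow> length (fst (M ! t)) = 1
         | Some q \<Rightarrow> 1 \<le> q \<and> q \<noteq> phrase_start M t \<and>
             substr w q (q + length (fst (M ! t)) - 1) = fst (M ! t))) \<and>
     acyclic (pointers M)"

definition bms :: "nat list \<Rightarrow> nat" where
  "bms w = (LEAST m. \<exists>M. macro_scheme M w \<and> m = length M)"


section \<open>NU-systems\<close>

text \<open>\<open>Ext a k i j\<close> is the extraction symbol \<open>a(k)[i:j]\<close>.\<close>

datatype nu_symbol = Sym nat | Ext nat nat nat nat

record nu_system =
  nu_alphabet :: "nat set"
  nu_rule :: "nat \<Rightarrow> nu_symbol list"
  nu_coding :: "nat \<Rightarrow> nat"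
  nu_start :: "nu_symbol list"
  nu_depth :: nat
  nu_length :: nat

text \<open>
  Loops are excluded at the granularity of single symbols, since an extraction may refer to a
  level in which it occurs itself: with \<open>R(a) = x a(1)[1:5]\<close>, level 1 of \<open>a\<close> is a
  run of six \<open>x\<close> (if \<open>x\<close> is coded as itself). The levels are hence not computed as whole strings;
  instead the following inductive predicates say which of their symbols are determined, and a
  circular dependency shows up as the absence of a derivation.

  An entry \<open>Pick a m r\<close> of a level is the ordinary symbol that was put there by a former
  extraction, namely the coding of the \<open>r\<close>-th symbol of level \<open>m\<close> from \<open>a\<close>. It is known to be
  an ordinary symbol before it is known which one, so that it can be skipped when counting
  positions of the final string, but not when counting positions of the next level.
\<close>

datatype nu_entry = Plain nu_symbol | Pick nat nat nat

fun image_length :: "(nat \<Rightarrow> nu_symbol list) \<Rightarrow> nu_symbol \<Rightarrow> nat" where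
  "image_length R (Sym a) = length (R a)"
| "image_length R (Ext a m i j) = j + 1 - i"

fun string_length :: "nu_entry \<Rightarrow> nat" where
  "string_length (Plain (Ext a m i j)) = j + 1 - i"
| "string_length (Plain (Sym a)) = 1"
| "string_length (Pick a m r) = 1"

text \<open>
  For the \<open>k\<close>-th level from \<open>X\<close>: \<open>entry_at X k p\<close> and \<open>symbol_at X k p\<close> concern its \<open>p\<close>-th entry
  (from 0), where the latter resolves \<^const>\<open>Pick\<close>; \<open>string_at X k p\<close> concerns the \<open>p\<close>-th symbol
  (from 1, as in \<open>a(k)[i:j]\<close>) of the level after all remaining extraction symbols in it have been
  replaced. In each rule \<open>us\<close> is a prefix of the level, needed to count positions.
\<close>

inductive entry_at :: "(nat \<Rightarrow> nu_symbol list) \<Rightarrow> (nat \<Rightarrow> nat) \<Rightarrow>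
      nu_symbol list \<Rightarrow> nat \<Rightarrow> nat \<Rightarrow> nu_entry \<Rightarrow> bool"
  and symbol_at :: "(nat \<Rightarrow> nu_symbol list) \<Rightarrow> (nat \<Rightarrow> nat) \<Rightarrow>
      nu_symbol list \<Rightarrow> nat \<Rightarrow> nat \<Rightarrow> nu_symbol \<Rightarrow> bool"
  and string_at :: "(nat \<Rightarrow> nu_symbol list) \<Rightarrow> (nat \<Rightarrow> nat) \<Rightarrow>
      nu_symbol list \<Rightarrow> nat \<Rightarrow> nat \<Rightarrow> nat \<Rightarrow> bool"
  for R \<tau> where
  entry_start:
    "p < length X \<Longrightarrow> entry_at R \<tau> X 0 p (Plain (X ! p))"
| entry_rule:
    "\<lbrakk>\<forall>t<length us. symbol_at R \<tau> X k t (us ! t);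
      symbol_at R \<tau> X k (length us) (Sym a); r < length (R a)\<rbrakk> \<Longrightarrow>
     entry_at R \<tau> X (Suc k) (sum_list (map (image_length R) us) + r) (Plain (R a ! r))"
| entry_extract:
    "\<lbrakk>\<forall>t<length us. symbol_at R \<tau> X k t (us ! t);
      symbol_at R \<tau> X k (length us) (Ext a m i j); i \<le> r; r \<le> j\<rbrakk> \<Longrightarrow>
     entry_at R \<tau> X (Suc k) (sum_list (map (image_length R) us) + (r - i)) (Pick a m r)"
| symbol_plain:
    "entry_at R \<tau> X k p (Plain x) \<Longrightarrow> symbol_at R \<tau> X k p x"
| symbol_pick:
    "\<lbrakk>entry_at R \<tau> X k p (Pick a m r); string_at R \<tau> [Sym a] m r c\<rbrakk> \<Longrightarrow>
     symbol_at R \<tau> X k p (Sym (\<tau> c))"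
| string_symbol:
    "\<lbrakk>\<forall>t<length us. entry_at R \<tau> X k t (us ! t);
      symbol_at R \<tau> X k (length us) (Sym a)\<rbrakk> \<Longrightarrow>
     string_at R \<tau> X k (sum_list (map string_length us) + 1) a"
| string_extract:
    "\<lbrakk>\<forall>t<length us. entry_at R \<tau> X k t (us ! t);
      symbol_at R \<tau> X k (length us) (Ext a m i j); i \<le> r; r \<le> j;
      string_at R \<tau> [Sym a] m r c\<rbrakk> \<Longrightarrow>
     string_at R \<tau> X k (sum_list (map string_length us) + (r - i) + 1) (\<tau> c)"

fun nu_symbol_ok :: "nat set \<Rightarrow> nat \<Rightarrow> nu_symbol \<Rightarrow> bool" where
  "nu_symbol_ok V n (Sym a) \<longleftrightarrow> a \<in> V"
| "nu_symbol_ok V n (Ext a k i j) \<longleftrightarrow> a \<in> V \<and> k \<le> n \<and> 1 \<le> i \<and> i \<le> j \<and> j \<le> n"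

definition nu_symbols :: "nu_system \<Rightarrow> nu_symbol set" where
  "nu_symbols N = set (nu_start N) \<union> (\<Union>a\<in>nu_alphabet N. set (nu_rule N a))"

definition loop_free :: "nu_system \<Rightarrow> bool" where
  "loop_free N \<longleftrightarrow>
     (\<forall>a k i j. Ext a k i j \<in> nu_symbols N \<longrightarrow>
        (\<forall>r\<in>{i..j}. \<exists>c. string_at (nu_rule N) (nu_coding N) [Sym a] k r c)) \<and>
     (\<forall>r\<in>{1..nu_length N}. \<exists>c. string_at (nu_rule N) (nu_coding N) (nu_start N) (nu_depth N) r c)"

text \<open>
  The level \<open>d\<close> is bounded by \<open>n\<close> like every other index. A polynomial bound on the alphabet would
  be redundant for \<open>\<nu>\<close>: the system with axiom \<open>w\<close> and depth 0 has size at most \<open>3n + 2\<close>, so an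
  optimal one has no larger alphabet.
\<close>

definition is_nu_system :: "nu_system \<Rightarrow> bool" where
  "is_nu_system N \<longleftrightarrow>
     finite (nu_alphabet N) \<and>
     (\<forall>a\<in>nu_alphabet N. nu_rule N a \<noteq> [] \<and> nu_coding N a \<in> nu_alphabet N) \<and>
     nu_start N \<noteq> [] \<and>
     (\<forall>x\<in>nu_symbols N. nu_symbol_ok (nu_alphabet N) (nu_length N) x) \<and>
     nu_depth N \<le> nu_length N \<and> 1 \<le> nu_length N \<and>
     loop_free N"

definition nu_generates :: "nu_system \<Rightarrow> nat list \<Rightarrow> bool" where
  "nu_generates N w \<longleftrightarrow>
     length w = nu_length N \<and>
     (\<forall>r\<in>{1..nu_length N}. \<exists>c. w ! (r - 1) = nu_coding N c \<and>
        string_at (nu_rule N) (nu_coding N) (nu_start N) (nu_depth N) r c)"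

fun symbol_size :: "nu_symbol \<Rightarrow> nat" where
  "symbol_size (Sym a) = 1"
| "symbol_size (Ext a k i j) = 4"

definition nu_size :: "nu_system \<Rightarrow> nat" where
  "nu_size N = (\<Sum>a\<in>nu_alphabet N. sum_list (map symbol_size (nu_rule N a)))
     + sum_list (map symbol_size (nu_start N)) + card (nu_alphabet N) + 2"

definition nu :: "nat list \<Rightarrow> nat" where
  "nu w = (LEAST m. \<exists>N. is_nu_system N \<and> nu_generates N w \<and> m = nu_size N)"

end

theory Submission
  imports Defs
begin

text \<open>
  A symbol of an L-system of size \<open>T\<close> carries only \<open>O(log T)\<close> bits, whereas an extraction symbol
  carries \<open>O(log n)\<close> bits. For fixed \<open>T\<close> there are finitely many L-systems up to renaming, depth and
  length, so they generate only \<open>O(n\<^sup>K\<^sup>+\<^sup>1)\<close> strings of length at most \<open>n\<close> with depth at most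
  \<open>n\<^sup>K\<close>. On the other hand, \<open>K + 2\<close> extraction symbols suffice to choose the last \<open>K + 2\<close> gaps of
  \<open>1 0\<^sup>0 1 0\<^sup>1 1 0\<^sup>2 1 \<dots>\<close> freely, which gives \<open>\<Omega>(n\<^sup>K\<^sup>+\<^sup>2)\<close> strings, so that one of them has
  \<open>\<ell> > T = (K + 1)\<^sup>2\<close> while \<open>\<nu> = O(K)\<close>. The common prefix, with gaps \<open>0, \<dots>, T - 1\<close>, is generated by
  a constant number of rules and forces \<open>b > T\<close>, since each factor \<open>1 0\<^sup>i 1\<close> in it is unique
  and therefore not contained in a copied phrase.
\<close>

section \<open>Positions in concatenations and elementary laws of morphisms\<close>

lemma nth_concat_cases:
  assumes "p < length (concat xss)"
  obtains t j where "t < length xss" "j < length (xss ! t)"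
    "p = sum_list (map length (take t xss)) + j" "concat xss ! p = xss ! t ! j"
  using assms
proof (induction xss arbitrary: p thesis)
  case (Cons xs xss)
  show ?case
  proof (cases "p < length xs")
    case True
    then show ?thesis by (intro Cons.prems(1)[of 0 p]) (auto simp: nth_append)
  next
    case False
    then have "p - length xs < length (concat xss)" using Cons.prems(2) by auto
    then obtain t j where "t < length xss" "j < length (xss ! t)"
      "p - length xs = sum_list (map length (take t xss)) + j"
      "concat xss ! (p - length xs) = xss ! t ! j"
      using Cons.IH by blast
    then show ?thesis using False
      by (intro Cons.prems(1)[of "Suc t" j]) (auto simp: nth_append)
  qed
qed simp

lemma morph_Nil [simp]: "morph f [] = []"
  and morph_Cons [simp]: "morph f (a # u) = f a @ morph f u"
  and morph_append [simp]: "morph f (u @ v) = morph f u @ morph f v"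
  by (simp_all add: morph_def)

lemma funpow_morph_append: "(morph f ^^ k) (u @ v) = (morph f ^^ k) u @ (morph f ^^ k) v"
  by (induction k) auto

section \<open>Counting L-systems\<close>

text \<open>A \<open>LEAST\<close> over an inhabited set is attained; the axiom \<open>w\<close> at
  depth 0 inhabits it. Here \<open>c \<ge> 1\<close> makes the bound \<open>n ^ c\<close> large
  enough for the letters of \<open>w\<close>.\<close>

lemma ell_witness:
  assumes "w \<noteq> []" "c \<ge> 1"
  obtains L where "is_l_system L" "l_generates L w" "l_depth L \<le> l_length L ^ c"
    "ell c w = l_size L"
proof -
  define L0 where "L0 = \<lparr>l_alphabet = set w, l_rule = (\<lambda>a. [a]), l_coding = (\<lambda>a. a),
    l_start = w, l_depth = 0, l_length = length w\<rparr>"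
  have "card (set w) \<le> length w ^ c"
    using card_length[of w] self_le_power[of "length w" c] assms
    by (metis One_nat_def Suc_leI le_trans length_greater_0_conv less_eq_Suc_le)
  then have "is_l_system L0 \<and> l_generates L0 w \<and> l_depth L0 \<le> l_length L0 ^ c \<and>
      card (l_alphabet L0) \<le> l_length L0 ^ c"
    using assms by (simp add: L0_def is_l_system_def l_generates_def Suc_le_eq)
  then have "\<exists>m L. is_l_system L \<and> l_generates L w \<and>
      l_depth L \<le> l_length L ^ c \<and> card (l_alphabet L) \<le> l_length L ^ c \<and> m = l_size L"
    by blast
  then have "\<exists>L. is_l_system L \<and> l_generates L w \<and> l_depth L \<le> l_length L ^ c \<and>
      card (l_alphabet L) \<le> l_length L ^ c \<and> ell c w = l_size L"
    unfolding ell_def by (rule LeastI_ex)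
  then show ?thesis using that by blast
qed

text \<open>Allows the alphabet to be renamed to an initial segment of the naturals. Commutation is
  required only on the closed set \<open>A\<close>, since an L-system constrains its rules only on
  its alphabet.\<close>

lemma funpow_morph_rename:
  assumes closed: "\<And>a. a \<in> A \<Longrightarrow> set (f a) \<subseteq> A"
    and comm: "\<And>a. a \<in> A \<Longrightarrow> f' (h a) = map h (f a)" and "set u \<subseteq> A"
  shows "(morph f' ^^ k) (map h u) = map h ((morph f ^^ k) u)" "set ((morph f ^^ k) u) \<subseteq> A"
proof (induction k)
  case (Suc k)
  have *: "morph f' (map h v) = map h (morph f v)" if "set v \<subseteq> A" for v
    using that by (induction v) (auto simp: comm)
  {
    case 1 show ?case using Suc * by simp
  next
    case 2 show ?case using Suc closed by (fastforce simp: morph_def)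
  }
qed (use assms in auto)

type_synonym l_shape = "nat list list \<times> nat list \<times> nat list"

text \<open>A shape is an L-system up to renaming, stripped of depth and length: the list of rules,
  the list of codes, and the axiom. Symbols become indices below \<open>T\<close>, while codes stay
  actual letters of \<open>B\<close>. The number of shapes is thus independent of
  \<open>n\<close>.\<close>

definition l_shapes :: "nat \<Rightarrow> nat set \<Rightarrow> l_shape set" where
  "l_shapes T B =
     {rs. set rs \<subseteq> {xs. set xs \<subseteq> {..<T} \<and> length xs \<le> T} \<and> length rs \<le> T} \<times>
     {ts. set ts \<subseteq> B \<and> length ts \<le> T} \<times> {xs. set xs \<subseteq> {..<T} \<and> length xs \<le> T}"

fun shape_string :: "l_shape \<times> nat \<times> nat \<Rightarrow> nat list" where
  "shape_string ((rs, ts, xs), d, n) = take n (map ((!) ts) ((morph ((!) rs) ^^ d) xs))"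

lemma finite_l_shapes: "finite B \<Longrightarrow> finite (l_shapes T B)"
  unfolding l_shapes_def by (intro finite_cartesian_product finite_lists_length_le) auto

lemma l_system_shape:
  assumes L: "is_l_system L" "l_generates L w" "l_size L \<le> T" and w: "set w \<subseteq> B" "w \<noteq> []"
  shows "\<exists>S \<in> l_shapes T B. w = shape_string (S, l_depth L, length w)"
proof -
  define A where "A = l_alphabet L"
  define f where "f = l_rule L"
  have fin: "finite A" and rule: "\<And>a. a \<in> A \<Longrightarrow> set (f a) \<subseteq> A"
    and start: "set (l_start L) \<subseteq> A"
    using L(1) by (auto simp: is_l_system_def A_def f_def)
  obtain b where b: "b \<in> B" using w by (cases w) auto
  obtain h where h: "bij_betw h A {0..<card A}" using ex_bij_betw_finite_nat[OF fin] by blast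
  define g where "g = inv_into A h"
  have gA: "g i \<in> A" if "i < card A" for i
    using bij_betwE[OF bij_betw_inv_into[OF h]] that by (auto simp: g_def)
  have hA: "h a < card A" and gh: "g (h a) = a" if "a \<in> A" for a
    using bij_betwE[OF h] bij_betw_inv_into_left[OF h] that by (auto simp: g_def)
  \<comment> \<open>Codes outside \<open>B\<close> only occur beyond the prefix \<open>w\<close>.\<close>
  define code where "code a = (if l_coding L a \<in> B then l_coding L a else b)" for a
  define rs where "rs = map (\<lambda>i. map h (f (g i))) [0..<card A]"
  define ts where "ts = map (code \<circ> g) [0..<card A]"
  define xs where "xs = map h (l_start L)"
  define Y where "Y = (morph f ^^ l_depth L) (l_start L)"
  \<comment> \<open>The size bounds the alphabet, the axiom and each right-hand side separately, so
    all lists of the shape have length at most \<open>T\<close>.\<close>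
  have card_le: "card A \<le> T" and start_le: "length (l_start L) \<le> T"
    using L(3) by (auto simp: l_size_def A_def)
  have rule_le: "length (f a) \<le> T" if "a \<in> A" for a
    using L(3) member_le_sum[OF that _ fin, of "\<lambda>a. length (f a)"]
    by (simp add: l_size_def A_def f_def)
  have "(rs, ts, xs) \<in> l_shapes T B"
    unfolding l_shapes_def
  proof (intro SigmaI CollectI conjI subsetI)
    have hT: "h a < T" if "a \<in> A" for a using hA[OF that] card_le by simp
    fix ys assume "ys \<in> set rs"
    then obtain i where i: "i < card A" "ys = map h (f (g i))" by (auto simp: rs_def)
    show "y \<in> {..<T}" if "y \<in> set ys" for y
      using that i hT rule[OF gA[OF i(1)]] by auto
    show "length ys \<le> T" using i rule_le[OF gA[OF i(1)]] by simp
  next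
    show "y \<in> {..<T}" if "y \<in> set xs" for y
      using that start hA card_le by (fastforce simp: xs_def)
  qed (use card_le start_le b in \<open>auto simp: rs_def ts_def xs_def code_def\<close>)
  moreover have "w = shape_string ((rs, ts, xs), l_depth L, length w)"
  proof -
    have Y: "(morph ((!) rs) ^^ l_depth L) xs = map h Y" "set Y \<subseteq> A"
      unfolding Y_def xs_def
      by (rule funpow_morph_rename[where A = A]; use rule start hA gh in \<open>auto simp: rs_def\<close>)+
    have "map ((!) ts) (map h Y) = map code Y"
      using Y(2) hA gh by (auto simp: ts_def)
    moreover have w_eq: "w = map (l_coding L) (take (length w) Y)"
      using L(2) unfolding l_generates_def Y_def f_def by (metis take_map)
    moreover have "map (l_coding L) (take (length w) Y) = map code (take (length w) Y)"
    proof (rule map_cong[OF refl])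
      fix a assume "a \<in> set (take (length w) Y)"
      then have "l_coding L a \<in> set w" by (subst w_eq) simp
      then show "l_coding L a = code a" using w(1) by (auto simp: code_def)
    qed
    ultimately have "w = take (length w) (map ((!) ts) (map h Y))" by (metis take_map)
    then show ?thesis unfolding shape_string.simps Y(1) .
  qed
  ultimately show ?thesis by blast
qed

text \<open>Pigeonhole: a string with \<open>ell c w \<le> T\<close> is determined by a shape, a
  depth and a length. Since the depth is at most \<open>length w ^ c \<le> n ^ K\<close>, the same
  count handles all exponents \<open>c \<le> K\<close> at once, so one string works for all of
  them.\<close>

lemma exists_large_ell:
  assumes "finite B" and W: "\<And>w. w \<in> W \<Longrightarrow> set w \<subseteq> B \<and> w \<noteq> [] \<and> length w \<le> n"
    and many: "card (l_shapes T B) * (Suc (n ^ K) * Suc n) < card W"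
  obtains w where "w \<in> W" "\<And>c. 1 \<le> c \<Longrightarrow> c \<le> K \<Longrightarrow> T < ell c w"
proof -
  define D where "D = l_shapes T B \<times> {..n ^ K} \<times> {..n}"
  have "finite D" using assms(1) by (simp add: D_def finite_l_shapes)
  then have "card (shape_string ` D) \<le> card D" "finite (shape_string ` D)"
    by (simp_all add: card_image_le)
  moreover have "card D < card W" using many by (simp add: D_def card_cartesian_product)
  ultimately obtain w where w: "w \<in> W" "w \<notin> shape_string ` D"
    by (metis card_mono leD le_less_trans subsetI)
  have "T < ell c w" if c: "1 \<le> c" "c \<le> K" for c
  proof (rule ccontr)
    assume "\<not> T < ell c w"
    obtain L where L: "is_l_system L" "l_generates L w" "l_depth L \<le> l_length L ^ c"
      "ell c w = l_size L"
      using ell_witness c W[OF w(1)] by metis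
    with \<open>\<not> T < ell c w\<close> obtain S where S: "S \<in> l_shapes T B"
      "w = shape_string (S, l_depth L, length w)"
      using l_system_shape[of L w T B] W[OF w(1)] by auto
    have len: "l_length L = length w" "length w \<ge> 1" "length w \<le> n"
      using L(2) W[OF w(1)] by (auto simp: l_generates_def Suc_le_eq)
    have "l_depth L \<le> length w ^ K"
      using L(3) c len power_increasing[of c K "length w"] by simp
    also have "\<dots> \<le> n ^ K" using len by (simp add: power_mono)
    finally have "(S, l_depth L, length w) \<in> D" using S len by (simp add: D_def)
    then show False using w(2) S(2) by blast
  qed
  then show ?thesis using that w(1) by blast
qed

section \<open>Macro-schemes and unique substrings\<close>

lemma bms_witness:
  obtains M where "macro_scheme M w" "bms w = length M"
proof -
  have "macro_scheme (map (\<lambda>a. ([a], None)) w) w"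
    by (simp add: macro_scheme_def pointers_def comp_def acyclic_def cong: conj_cong)
  then have "\<exists>m M. macro_scheme M w \<and> m = length M" by blast
  then have "\<exists>M. macro_scheme M w \<and> bms w = length M"
    unfolding bms_def by (rule LeastI_ex)
  then show ?thesis using that by blast
qed

text \<open>The factor from position \<open>x i\<close> through \<open>x (Suc i)\<close>, both ends
  included, occurs only once in \<open>w\<close>. A copied phrase containing it would have to be its
  own source, so every phrase boundary can advance past at most one \<open>x i\<close>, and
  \<open>m\<close> phrases cannot cover \<open>w\<close>.\<close>

lemma macro_scheme_length_gt:
  assumes M: "macro_scheme M w"
    and x: "\<And>i. i < m \<Longrightarrow> x i < x (Suc i)" "x m < length w"
    and uniq: "\<And>i y. \<lbrakk>i < m; y + (x (Suc i) - x i) < length w;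
      \<And>r. r \<le> x (Suc i) - x i \<Longrightarrow> w ! (y + r) = w ! (x i + r)\<rbrakk> \<Longrightarrow> y = x i"
  shows "m < length M"
proof -
  \<comment> \<open>\<open>E i\<close> is the 0-based start of phrase \<open>i\<close>, hence
    \<open>phrase_start M i = 1 + E i\<close>. The invariant below is
    \<open>E i \<le> x i\<close>.\<close>
  define E where "E i = length (concat (map fst (take i M)))" for i
  have w: "concat (map fst M) = w" using M by (simp add: macro_scheme_def)
  have x_mono: "x i \<le> x m" if "i \<le> m" for i
    using that
  proof (induction rule: inc_induct)
    case (step n)
    then show ?case using x(1)[of n] by simp
  qed simp
  have E_ge: "E i = length w" if "length M \<le> i" for i
    using that w by (simp add: E_def)
  have "i \<le> m \<Longrightarrow> E i \<le> x i" for i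
  proof (induction i)
    case (Suc i)
    then have i: "i < m" and Ei: "E i \<le> x i" by simp_all
    have "x i < length w" using x(2) x_mono[of i] i by simp
    then have iM: "i < length M" using Ei E_ge[of i] by (cases "i < length M") auto
    define u where "u = fst (M ! i)"
    have E_Suc: "E (Suc i) = E i + length u"
      using iM by (simp add: E_def u_def take_Suc_conv_app_nth)
    have w_split: "w = concat (map fst (take i M)) @ u @ concat (map fst (drop (Suc i) M))"
      using arg_cong[OF id_take_nth_drop[OF iM], of "\<lambda>M. concat (map fst M)"] w
      by (simp add: u_def)
    then have w_u: "w ! (E i + r) = u ! r" if "r < length u" for r
      using that by (simp add: E_def nth_append)
    show ?case
    proof (rule ccontr)
      assume "\<not> E (Suc i) \<le> x (Suc i)"
      \<comment> \<open>Phrase \<open>i\<close> now contains both \<open>x i\<close> and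
        \<open>x (Suc i)\<close>, so it has at least two letters and must be a copy.\<close>
      then have in_u: "x (Suc i) < E i + length u" using E_Suc by simp
      moreover have lt: "x i < x (Suc i)" using x(1) i by blast
      ultimately have "length u \<noteq> 1" using Ei by simp
      moreover have "case snd (M ! i) of None \<Rightarrow> length u = 1
         | Some q \<Rightarrow> 1 \<le> q \<and> q \<noteq> phrase_start M i \<and> substr w q (q + length u - 1) = u"
        using M iM unfolding macro_scheme_def u_def by blast
      ultimately obtain q where q: "1 \<le> q" "q \<noteq> phrase_start M i"
        "substr w q (q + length u - 1) = u"
        by (auto split: option.splits)
      have u: "take (length u) (drop (q - 1) w) = u" using q(1,3) by (simp add: substr_def)
      have "length u \<noteq> 0" using in_u Ei lt by auto
      with arg_cong[OF u, of length] have u_len: "q - 1 + length u \<le> length w"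
        unfolding length_take length_drop by linarith
      have w_q: "w ! (q - 1 + r) = u ! r" if "r < length u" for r
        using arg_cong[OF u, of "\<lambda>v. v ! r"] that u_len by simp
      \<comment> \<open>The source contains the factor at the same offset \<open>x i - E i\<close>
        as the phrase (\<open>q\<close> counts from 1). Uniqueness of the occurrence then makes
        source and phrase start at the same position.\<close>
      have "q - 1 + (x i - E i) = x i"
      proof (rule uniq[OF i])
        show "q - 1 + (x i - E i) + (x (Suc i) - x i) < length w"
          using u_len in_u Ei lt by linarith
        fix r assume "r \<le> x (Suc i) - x i"
        then have r: "x i - E i + r < length u" using in_u Ei lt by linarith
        have "E i + (x i - E i + r) = x i + r" using Ei by simp
        then show "w ! (q - 1 + (x i - E i) + r) = w ! (x i + r)"
          using w_q[OF r] w_u[OF r] by (metis add.assoc)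
      qed
      then have "q = 1 + E i" using Ei q(1) by linarith
      then show False using q(2) by (simp add: phrase_start_def E_def)
    qed
  qed (simp add: E_def)
  then have "E m < length w" using x(2) by (meson le_less_trans order_refl)
  then show ?thesis using E_ge[of m] by (cases "m < length M") auto
qed

section \<open>Strings with prescribed gaps\<close>

definition block :: "nat \<Rightarrow> nat list" where
  "block g = 1 # replicate g 0"

definition gap_string :: "nat list \<Rightarrow> nat list" where
  "gap_string gs = concat (map block gs)"

lemma length_block [simp]: "length (block g) = Suc g"
  by (simp add: block_def)

lemma nth_block: "j \<le> g \<Longrightarrow> block g ! j = (if j = 0 then 1 else 0)"
  by (auto simp: block_def nth_Cons')

lemma length_gap_string: "length (gap_string gs) = sum_list (map Suc gs)"
  by (simp add: gap_string_def length_concat comp_def)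

lemma set_gap_string: "set (gap_string gs) \<subseteq> {0, 1}"
  by (auto simp: gap_string_def block_def)

text \<open>The gaps can be read off from left to right: after the leading 1, the maximal run of
  zeros is the first gap. Counting gap lists therefore counts strings.\<close>

lemma gap_string_inject: "gap_string gs = gap_string hs \<Longrightarrow> gs = hs"
proof (induction gs arbitrary: hs)
  case Nil
  then show ?case by (cases hs) (auto simp: gap_string_def block_def)
next
  case (Cons g gs)
  have *: "takeWhile (\<lambda>a. a = 0) (replicate k 0 @ gap_string ks) = replicate k 0" for k ks
    by (cases ks) (auto simp: gap_string_def block_def takeWhile_append)
  obtain h hs' where hs: "hs = h # hs'"
    using Cons.prems by (cases hs) (auto simp: gap_string_def block_def)
  then have eq: "replicate g 0 @ gap_string gs = replicate h 0 @ gap_string hs'"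
    using Cons.prems by (simp add: gap_string_def block_def)
  then have "replicate g (0::nat) = replicate h 0" using * by metis
  then have "g = h" by (metis length_replicate)
  then show ?case using eq Cons.IH hs by simp
qed

lemma gap_string_nth:
  assumes "i < length gs" "j \<le> gs ! i"
  shows "gap_string gs ! (sum_list (map Suc (take i gs)) + j) = (if j = 0 then 1 else 0)"
proof -
  have "gap_string gs =
      gap_string (take i gs) @ block (gs ! i) @ gap_string (drop (Suc i) gs)"
    using arg_cong[OF id_take_nth_drop[OF assms(1)], of gap_string] by (simp add: gap_string_def)
  then show ?thesis using assms by (simp add: nth_append length_gap_string[symmetric] nth_block)
qed

text \<open>A gap that occurs once makes its factor, a 1 followed by the gap and the next 1, unique.
  The condition \<open>m < length gs\<close> supplies the closing 1 of the last of the
  \<open>m\<close> factors.\<close>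

lemma bms_gap_string_gt:
  assumes m: "m < length gs"
    and distinct: "\<And>i t. i < m \<Longrightarrow> t < length gs \<Longrightarrow> gs ! t = gs ! i \<Longrightarrow> t = i"
  shows "m < bms (gap_string gs)"
proof -
  let ?w = "gap_string gs"
  define x where "x i = sum_list (map Suc (take i gs))" for i
  have x_Suc: "x (Suc i) = x i + Suc (gs ! i)" if "i < length gs" for i
    using that by (simp add: x_def take_Suc_conv_app_nth)
  have x_len: "x (length gs) = length ?w" by (simp add: x_def length_gap_string)
  have x_lt: "x i < length ?w" if "i < length gs" for i
  proof -
    have "length ?w = sum_list (map Suc (take i gs @ drop i gs))"
      by (simp add: length_gap_string)
    also have "\<dots> = x i + sum_list (map Suc (drop i gs))" by (simp only: map_append sum_list_append x_def)
    also have "drop i gs = gs ! i # drop (Suc i) gs" using that by (rule Cons_nth_drop_Suc[symmetric])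
    finally show ?thesis by simp
  qed
  have w_nth: "?w ! (x i + j) = (if j = 0 then 1 else 0)" if "i < length gs" "j \<le> gs ! i" for i j
    using gap_string_nth[OF that] by (simp add: x_def)
  obtain M where M: "macro_scheme M ?w" "bms ?w = length M" using bms_witness by blast
  have "m < length M"
  proof (rule macro_scheme_length_gt[OF M(1)])
    fix i assume "i < m"
    then show "x i < x (Suc i)" using x_Suc m by simp
  next
    show "x m < length ?w" using x_lt m by simp
  next
    fix i y
    assume i: "i < m" and y: "y + (x (Suc i) - x i) < length ?w"
      and eq: "\<And>r. r \<le> x (Suc i) - x i \<Longrightarrow> ?w ! (y + r) = ?w ! (x i + r)"
    define g where "g = gs ! i"
    have g: "x (Suc i) - x i = Suc g" using x_Suc i m by (simp add: g_def)
    have iL: "i < length gs" "Suc i < length gs" using i m by simp_all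
    have y0: "?w ! y = 1" using eq[of 0] w_nth[OF iL(1), of 0] by simp
    have ymid: "?w ! (y + r) = 0" if "0 < r" "r \<le> g" for r
      using eq[of r] w_nth[OF iL(1), of r] that by (simp add: g g_def)
    have yend: "?w ! (y + Suc g) = 1"
      using eq[of "Suc g"] w_nth[OF iL(2), of 0] x_Suc[OF iL(1)] by (simp add: g g_def)
    have "y < length (concat (map block gs))" using y by (simp add: gap_string_def)
    \<comment> \<open>Position \<open>y\<close> lies in block \<open>t\<close> at offset
      \<open>j\<close>; as it carries a 1, it must be the start of that block.\<close>
    then obtain t j where "t < length (map block gs)" "j < length (map block gs ! t)"
      "y = sum_list (map length (take t (map block gs))) + j"
      by (rule nth_concat_cases)
    then have t: "t < length gs" "j \<le> gs ! t" "y = x t + j"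
      by (simp_all add: take_map comp_def x_def)
    have "j = 0"
    proof (rule ccontr)
      assume "j \<noteq> 0"
      then have "?w ! (x t + j) = 0" using w_nth[OF t(1,2)] by simp
      then show False using y0 t(3) by simp
    qed
    then have yt: "y = x t" using t(3) by simp
    have "gs ! t = g"
    \<comment> \<open>A longer gap would put a 0 where the closing 1 is expected, and a shorter one
      would put the next 1 among the zeros. In the latter case that next block exists because the
      occurrence fits into the string.\<close>
    proof (rule antisym; rule leI; rule notI)
      assume "g < gs ! t"
      then show False using w_nth[OF t(1), of "Suc g"] yend yt by simp
    next
      assume less: "gs ! t < g"
      have x_t: "x (Suc t) = y + Suc (gs ! t)" using x_Suc[OF t(1)] yt by simp
      then have "x (Suc t) < length ?w" using y less g by simp
      then have "Suc t < length gs" using x_len t(1) by (cases "Suc t = length gs") auto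
      then have "?w ! (y + Suc (gs ! t)) = 1" using w_nth[of "Suc t" 0] x_t by simp
      then show False using ymid[of "Suc (gs ! t)"] less by simp
    qed
    then show "y = x i" using distinct[OF i t(1)] yt g_def by simp
  qed
  then show ?thesis using M by simp
qed

section \<open>NU-systems\<close>

text \<open>Without extraction symbols in the rules and the axiom, the levels are plain iterates of
  a morphism. Each entry is derived by locating it in the image of one symbol of the previous
  level.\<close>

lemma entry_at_morph:
  assumes "p < length ((morph f ^^ k) u)"
  shows "entry_at (\<lambda>a. map Sym (f a)) \<tau> (map Sym u) k p (Plain (Sym ((morph f ^^ k) u ! p)))"
  using assms
proof (induction k arbitrary: p)
  case 0
  then show ?case using entry_start[of p "map Sym u"] by simp
next
  case (Suc k)
  define v where "v = (morph f ^^ k) u"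
  let ?R = "\<lambda>a. map Sym (f a)"
  have "p < length (concat (map f v))" using Suc.prems by (simp add: v_def morph_def[of f "(morph f ^^ k) u"])
  then obtain t j where tj: "t < length (map f v)" "j < length (map f v ! t)"
    "p = sum_list (map length (take t (map f v))) + j"
    "concat (map f v) ! p = map f v ! t ! j"
    by (rule nth_concat_cases)
  define us where "us = map Sym (take t v)"
  have sym: "symbol_at ?R \<tau> (map Sym u) k i (Sym (v ! i))" if "i < length v" for i
    using Suc.IH[of i] that by (auto simp: v_def intro: symbol_plain)
  have "entry_at ?R \<tau> (map Sym u) (Suc k) (sum_list (map (image_length ?R) us) + j)
      (Plain (?R (v ! t) ! j))"
    by (rule entry_rule) (use sym tj in \<open>auto simp: us_def\<close>)
  moreover have "sum_list (map (image_length ?R) us) + j = p"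
    using tj by (simp add: us_def comp_def take_map)
  moreover have "(morph f ^^ Suc k) u ! p = f (v ! t) ! j"
    using tj by (simp add: v_def morph_def[of f "(morph f ^^ k) u"])
  ultimately show ?case using tj by simp
qed

lemma string_at_morph:
  assumes "p < length ((morph f ^^ k) u)"
  shows "string_at (\<lambda>a. map Sym (f a)) \<tau> (map Sym u) k (Suc p) ((morph f ^^ k) u ! p)"
proof -
  define v where "v = (morph f ^^ k) u"
  define us where "us = map (Plain \<circ> Sym) (take p v)"
  have "string_at (\<lambda>a. map Sym (f a)) \<tau> (map Sym u) k
      (sum_list (map string_length us) + 1) (v ! p)"
    by (rule string_symbol) (use entry_at_morph assms in \<open>auto simp: us_def v_def intro: symbol_plain\<close>)
  moreover have "sum_list (map string_length us) = p"
    using assms by (simp add: us_def v_def comp_def sum_list_triv)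
  ultimately show ?thesis by (simp add: v_def)
qed

text \<open>Evaluates a system at depth 0 whose axiom consists of extraction symbols only: the
  result is the concatenation of the extracted strings. Tuples stand for the extraction symbols so
  that \<open>ext\<close> and \<open>str\<close> can be mapped over one list.\<close>

lemma string_at_extractions:
  fixes ext :: "nat \<times> nat \<times> nat \<times> nat \<Rightarrow> nu_symbol" and str :: "nat \<times> nat \<times> nat \<times> nat \<Rightarrow> nat list"
  assumes ext: "\<And>a k i j. ext (a, k, i, j) = Ext a k i j"
    and str: "\<And>a k i j. (a, k, i, j) \<in> set es \<Longrightarrow> 1 \<le> i \<and> i \<le> j \<and>
      length (str (a, k, i, j)) = j + 1 - i \<and>
      (\<forall>r\<in>{i..j}. string_at R (\<lambda>a. a) [Sym a] k r (str (a, k, i, j) ! (r - i)))"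
    and p: "p < length (concat (map str es))"
  shows "string_at R (\<lambda>a. a) (map ext es) 0 (Suc p) (concat (map str es) ! p)"
proof -
  obtain t q where tq: "t < length (map str es)" "q < length (map str es ! t)"
    "p = sum_list (map length (take t (map str es))) + q"
    "concat (map str es) ! p = map str es ! t ! q"
    using p by (rule nth_concat_cases)
  obtain a k i j where e: "es ! t = (a, k, i, j)" by (cases "es ! t") auto
  have mem: "(a, k, i, j) \<in> set es" using e tq(1) by (metis length_map nth_mem)
  note s = str[OF mem]
  have len: "string_length (Plain (ext e)) = length (str e)" if "e \<in> set es" for e
  proof -
    obtain a k i j where "e = (a, k, i, j)" by (cases e) auto
    then show ?thesis using str[of a k i j] that ext by simp
  qed
  define us where "us = map (\<lambda>e. Plain (ext e)) (take t es)"
  have q: "q < j + 1 - i" using tq e s by simp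
  \<comment> \<open>Offset \<open>q\<close> within the extracted string is symbol
    \<open>i + q\<close> of the level; the form \<open>i + q - i\<close> matches
    \<open>string_extract\<close> with \<open>r = i + q\<close>.\<close>
  have "string_at R (\<lambda>a. a) (map ext es) 0
     (sum_list (map string_length us) + (i + q - i) + 1) (str (a, k, i, j) ! q)"
  proof (rule string_extract)
    show "\<forall>t<length us. entry_at R (\<lambda>a. a) (map ext es) 0 t (us ! t)"
      using entry_start[of _ "map ext es" R "\<lambda>a. a"] by (auto simp: us_def)
    have "length us = t" using tq(1) by (simp add: us_def)
    then show "symbol_at R (\<lambda>a. a) (map ext es) 0 (length us) (Ext a k i j)"
      using tq(1) e ext entry_start[of t "map ext es" R "\<lambda>a. a"] by (auto intro: symbol_plain)
    show "i \<le> i + q" "i + q \<le> j" using q by auto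
    then show "string_at R (\<lambda>a. a) [Sym a] k (i + q) (str (a, k, i, j) ! q)"
      using s by (metis add_diff_cancel_left' atLeastAtMost_iff)
  qed
  moreover have "sum_list (map string_length us) = sum_list (map length (take t (map str es)))"
    unfolding us_def take_map[symmetric] map_map
    by (rule arg_cong[of _ _ sum_list]) (auto simp: take_map comp_def dest!: in_set_takeD intro: len)
  ultimately show ?thesis using tq e by simp
qed

section \<open>An explicit NU-system for gap strings\<close>

text \<open>Symbol 1 gains one trailing zero per step. Symbol 2 emits a fresh 1 to its right at each
  step, so older blocks stand further right and have longer gaps.\<close>

definition gap_rule :: "nat \<Rightarrow> nat list" where
  "gap_rule a = (if a = 2 then [2, 1] else if a = 1 then [1, 0] else [a])"

lemma funpow_gap_rule_0: "(morph gap_rule ^^ k) [0] = [0]"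
  by (induction k) (simp_all add: gap_rule_def)

lemma funpow_gap_rule_1: "(morph gap_rule ^^ k) [1] = block k"
proof (induction k)
  case (Suc k)
  have "(morph gap_rule ^^ Suc k) [1] = (morph gap_rule ^^ k) ([1] @ [0])"
    \<comment> \<open>Peeling off the first step instead of the last splits the level into iterates
      of single symbols.\<close>
    unfolding funpow_Suc_right by (simp add: gap_rule_def)
  also have "\<dots> = block (Suc k)"
    unfolding funpow_morph_append Suc funpow_gap_rule_0
    by (simp add: block_def replicate_append_same)
  finally show ?case .
qed (simp add: block_def)

lemma funpow_gap_rule_2: "(morph gap_rule ^^ k) [2] = 2 # gap_string [0..<k]"
proof (induction k)
  case (Suc k)
  have "(morph gap_rule ^^ Suc k) [2] = (morph gap_rule ^^ k) ([2] @ [1])"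
    unfolding funpow_Suc_right by (simp add: gap_rule_def)
  also have "\<dots> = 2 # gap_string [0..<Suc k]"
    unfolding funpow_morph_append Suc funpow_gap_rule_1 by (simp add: gap_string_def)
  finally show ?case .
qed (simp add: gap_string_def)

text \<open>One extraction from level \<open>m\<close> of symbol 2 yields the common prefix, and one
  from level \<open>g\<close> of symbol 1 yields the block of each further gap \<open>g\<close>. The
  size is 5 for the rules, \<open>4 * (length gs + 1)\<close> for the axiom, 3 for the alphabet, and
  2.\<close>

lemma nu_gap_string_le:
  assumes "m \<ge> 1" "gs \<noteq> []"
  shows "nu (gap_string ([0..<m] @ gs)) \<le> 4 * length gs + 14"
proof -
  define w where "w = gap_string ([0..<m] @ gs)"
  define u where "u = gap_string [0..<m]"
  \<comment> \<open>Level \<open>m\<close> from 2 begins with the symbol 2, which is skipped.\<close>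
  define e0 where "e0 = (2 :: nat, m, 2 :: nat, Suc (length u))"
  define es where "es = e0 # map (\<lambda>g. (1, g, 1, Suc g)) gs"
  define ext where "ext = (\<lambda>(a, k, i, j). Ext a k i j)"
  define str where "str = (\<lambda>(a, k, i, j). substr ((morph gap_rule ^^ k) [a]) i j)"
  define R where "R a = map Sym (gap_rule a)" for a
  define N where "N = \<lparr>nu_alphabet = {0, 1, 2}, nu_rule = R, nu_coding = (\<lambda>a. a),
    nu_start = map ext es, nu_depth = 0, nu_length = length w\<rparr>"
  \<comment> \<open>The first bound keeps level \<open>m\<close> within the index limit; the second
    makes the interval from 2 to \<open>Suc (length u)\<close> nonempty.\<close>
  have u: "length u \<ge> m" "length u \<ge> 1"
    using assms(1) sum_list_mono[of "[0..<m]" "\<lambda>_. 1" Suc]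
    by (auto simp: u_def length_gap_string sum_list_triv)
  have w: "w = u @ gap_string gs" by (simp add: w_def u_def gap_string_def)
  have gs: "length w \<ge> length u + Suc g" if "g \<in> set gs" for g
    using that member_le_sum_list[of "Suc g" "map Suc gs"] by (simp add: w length_gap_string)
  obtain g0 where "g0 \<in> set gs" using assms(2) by (cases gs) auto
  \<comment> \<open>Skipping the symbol 2 shifts the right endpoint to
    \<open>Suc (length u)\<close>; a further block in \<open>gs\<close> keeps it at most
    \<open>length w\<close>.\<close>
  then have len_w: "length w \<ge> Suc (length u)" using gs by fastforce
  have concat: "concat (map str es) = w"
    by (simp add: es_def e0_def str_def substr_def funpow_gap_rule_1[unfolded One_nat_def]
        funpow_gap_rule_2 w comp_def u_def[symmetric])
      (simp add: gap_string_def)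
  have level: "i \<le> j \<and> 1 \<le> i \<and> j \<le> length ((morph gap_rule ^^ k) [a]) \<and>
      a \<in> {1, 2} \<and> k \<le> length w \<and> j \<le> length w"
    if "(a, k, i, j) \<in> set es" for a k i j
  proof -
    have "(a, k, i, j) = e0 \<or> (\<exists>g\<in>set gs. (a, k, i, j) = (1, g, 1, Suc g))"
      using that by (auto simp: es_def)
    then show ?thesis
    proof (elim disjE bexE)
      assume "(a, k, i, j) = e0"
      then show ?thesis using u len_w by (simp add: e0_def funpow_gap_rule_2 u_def[symmetric])
    next
      fix g assume "g \<in> set gs" "(a, k, i, j) = (1, g, 1, Suc g)"
      then show ?thesis using gs[of g] by (simp add: funpow_gap_rule_1[unfolded One_nat_def])
    qed
  qed
  have str: "1 \<le> i \<and> i \<le> j \<and> length (str (a, k, i, j)) = j + 1 - i \<and>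
      (\<forall>r\<in>{i..j}. string_at R (\<lambda>a. a) [Sym a] k r (str (a, k, i, j) ! (r - i)))"
    if "(a, k, i, j) \<in> set es" for a k i j
  proof (intro conjI ballI)
    fix r assume r: "r \<in> {i..j}"
    then have "i - 1 + (r - i) = r - 1" "r - i < j + 1 - i"
      "i - 1 \<le> length ((morph gap_rule ^^ k) [a])"
      using level[OF that] by auto
    then have "str (a, k, i, j) ! (r - i) = (morph gap_rule ^^ k) [a] ! (r - 1)"
      unfolding str_def substr_def prod.case by (metis nth_drop nth_take)
    moreover have "r - 1 < length ((morph gap_rule ^^ k) [a])" "r > 0"
      using r level[OF that] by auto
    ultimately show "string_at R (\<lambda>a. a) [Sym a] k r (str (a, k, i, j) ! (r - i))"
      using string_at_morph[of "r - 1" k gap_rule "[a]" "\<lambda>a. a"]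
      by (simp add: R_def[abs_def])
  qed (use level[OF that] in \<open>auto simp: str_def substr_def\<close>)
  have string: "string_at R (\<lambda>a. a) (map ext es) 0 r (w ! (r - 1))" if "r \<in> {1..length w}" for r
    using string_at_extractions[of ext es str R "r - 1"] str that
    by (auto simp: concat ext_def)
  have symbols: "nu_symbols N = ext ` set es \<union> Sym ` {0, 1, 2}"
    by (auto simp: nu_symbols_def N_def R_def gap_rule_def)
  have ext_symbols: "(a, k, i, j) \<in> set es" if "Ext a k i j \<in> nu_symbols N" for a k i j
    using that by (auto simp: symbols ext_def)
  have "loop_free N"
    unfolding loop_free_def
  proof (intro conjI allI impI ballI)
    fix a k i j r assume "Ext a k i j \<in> nu_symbols N" "r \<in> {i..j}"
    then show "\<exists>c. string_at (nu_rule N) (nu_coding N) [Sym a] k r c"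
      using str[OF ext_symbols] unfolding N_def nu_system.simps by blast
  next
    fix r assume "r \<in> {1..nu_length N}"
    then show "\<exists>c. string_at (nu_rule N) (nu_coding N) (nu_start N) (nu_depth N) r c"
      using string unfolding N_def nu_system.simps by blast
  qed
  moreover have "nu_symbol_ok {0, 1, 2} (length w) x" if "x \<in> nu_symbols N" for x
  proof (cases x)
    case (Sym a)
    then show ?thesis using that by (auto simp: symbols ext_def)
  next
    case (Ext a k i j)
    then show ?thesis using that level[OF ext_symbols] by auto
  qed
  ultimately have "is_nu_system N"
    using len_w by (simp add: is_nu_system_def) (simp add: N_def R_def gap_rule_def es_def)
  moreover have "nu_generates N w"
    using string by (auto simp: nu_generates_def N_def)
  moreover have "nu_size N = 4 * length gs + 14"
    by (simp add: nu_size_def N_def R_def gap_rule_def es_def e0_def ext_def comp_def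
        sum_list_triv)
  ultimately have "\<exists>N. is_nu_system N \<and> nu_generates N w \<and> 4 * length gs + 14 = nu_size N"
    by (intro exI[of _ N]) simp
  then show ?thesis unfolding nu_def w_def[symmetric] by (rule Least_le)
qed

section \<open>The family\<close>

lemma exists_separating_string:
  "\<exists>w. K < length w \<and> nu w \<le> 22 * Suc K \<and>
     (\<forall>c. 1 \<le> c \<longrightarrow> c \<le> K \<longrightarrow> Suc K ^ 2 \<le> min (ell c w) (bms w))"
proof -
  define m where "m = Suc K ^ 2"
  \<comment> \<open>There are \<open>m + (K + 2)\<close> blocks, each of length at most
    \<open>m + N \<le> Suc m * N\<close>, so all candidates have length at most
    \<open>D * N\<close>. \<open>N\<close> is then chosen so that the \<open>N ^ (K + 2)\<close>
    candidates exceed the at most \<open>4 * C * D ^ Suc K * N ^ Suc K\<close> strings with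
    \<open>ell c w \<le> m\<close>.\<close>
  define D where "D = (m + (K + 2)) * Suc m"
  define C where "C = card (l_shapes m {0, 1})"
  define N where "N = Suc (4 * C * D ^ Suc K)"
  \<comment> \<open>The free gaps are at least \<open>m\<close>, so they never repeat a gap of the
    prefix and the first \<open>m\<close> factors stay unique.\<close>
  define G where "G = {ps. set ps \<subseteq> {m..<m + N} \<and> length ps = K + 2}"
  define mk where "mk ps = gap_string ([0..<m] @ ps)" for ps
  have m: "m \<ge> 1" "K < m" by (simp_all add: m_def power2_eq_square)
  have pos: "D \<ge> 1" "N \<ge> 1" by (simp_all add: D_def N_def)
  have card: "card (mk ` G) = N ^ (K + 2)"
  proof -
    have "inj_on mk G" by (rule inj_onI) (auto simp: mk_def dest: gap_string_inject)
    then show ?thesis by (simp add: card_image G_def card_lists_length_eq)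
  qed
  have mk: "set (mk ps) \<subseteq> {0, 1} \<and> mk ps \<noteq> [] \<and> length (mk ps) \<le> D * N \<and> m \<le> length (mk ps)"
    if "ps \<in> G" for ps
  proof -
    have len: "length (mk ps) = sum_list (map Suc ([0..<m] @ ps))"
      by (simp only: mk_def length_gap_string)
    have "Suc g \<le> Suc m * N" if "g \<in> set ([0..<m] @ ps)" for g
    proof -
      have "Suc g \<le> m + N" using that \<open>ps \<in> G\<close> pos by (fastforce simp: G_def)
      also have "\<dots> \<le> Suc m * N" using pos by simp
      finally show ?thesis .
    qed
    then have "sum_list (map Suc ([0..<m] @ ps)) \<le> sum_list (map (\<lambda>_. Suc m * N) ([0..<m] @ ps))"
      by (intro sum_list_mono) auto
    also have "\<dots> = D * N"
      using that by (simp add: G_def D_def sum_list_triv algebra_simps)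
    finally have upper: "length (mk ps) \<le> D * N" using len by simp
    have "sum_list (map (\<lambda>_. 1) [0..<m]) \<le> sum_list (map Suc [0..<m])"
      by (intro sum_list_mono) auto
    then have "m \<le> length (mk ps)" using len by (simp add: sum_list_triv)
    then show ?thesis using m upper set_gap_string by (auto simp: mk_def)
  qed
  have "C * (Suc ((D * N) ^ K) * Suc (D * N)) < card (mk ` G)"
  proof -
    have "1 \<le> D * N" using pos by simp
    then have "Suc ((D * N) ^ K) \<le> 2 * (D * N) ^ K" "Suc (D * N) \<le> 2 * (D * N)"
      using one_le_power[of "D * N" K] by simp_all
    then have "C * (Suc ((D * N) ^ K) * Suc (D * N)) \<le> C * ((2 * (D * N) ^ K) * (2 * (D * N)))"
      by (intro mult_le_mono) auto
    also have "\<dots> = (4 * C * D ^ Suc K) * N ^ Suc K"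
      by (simp add: power_mult_distrib algebra_simps)
    also have "\<dots> < N * N ^ Suc K"
      using pos by (intro mult_strict_right_mono) (auto simp: N_def)
    finally show ?thesis by (simp add: card)
  qed
  then obtain w where w: "w \<in> mk ` G" "\<And>c. 1 \<le> c \<Longrightarrow> c \<le> K \<Longrightarrow> m < ell c w"
    unfolding C_def by (rule exists_large_ell[rotated 2]) (use mk in auto)
  then obtain ps where ps: "ps \<in> G" "w = mk ps" by blast
  have "m < bms w"
    unfolding ps(2) mk_def
  proof (rule bms_gap_string_gt)
    show "m < length ([0..<m] @ ps)" using ps by (simp add: G_def)
    fix i t assume "i < m" "t < length ([0..<m] @ ps)"
      "([0..<m] @ ps) ! t = ([0..<m] @ ps) ! i"
    moreover have "m \<le> ps ! (t - m)" if "m \<le> t" "t < length ([0..<m] @ ps)"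
      using ps(1) that nth_mem[of "t - m" ps] by (force simp: G_def)
    ultimately show "t = i" by (fastforce simp: nth_append split: if_splits)
  qed
  \<comment> \<open>With \<open>K + 2\<close> free gaps the size bound is
    \<open>4 * (K + 2) + 14 = 4 * K + 22\<close>.\<close>
  moreover have "nu w \<le> 22 * Suc K"
    using nu_gap_string_le[of m ps] m ps by (fastforce simp: G_def mk_def)
  moreover have "K < length w" using mk[OF ps(1)] ps(2) m by simp
  ultimately show ?thesis using w(2) by (intro exI[of _ w]) (auto simp: m_def[symmetric] less_imp_le)
qed

lemma eventually_along:
  "eventually P (along F) \<longleftrightarrow> (\<exists>n. \<forall>w\<in>F. n \<le> length w \<longrightarrow> P w)"
  by (auto simp: along_def eventually_inf_principal eventually_filtercomap_at_top_linorder)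

theorem theorem2:
  "\<exists>F. string_family F \<and>
     (\<forall>c\<ge>1. (\<lambda>w. real (nu w)) \<in> o[along F](\<lambda>w. real (min (ell c w) (bms w))))"
proof -
  \<comment> \<open>One string per \<open>K\<close>, good for all exponents up to \<open>K\<close>,
    gives a family independent of \<open>c\<close>: a fixed \<open>c\<close> is covered by all but
    finitely many members.\<close>
  obtain f where len: "\<And>K. K < length (f K)" and nu: "\<And>K. nu (f K) \<le> 22 * Suc K"
    and big: "\<And>K c. 1 \<le> c \<Longrightarrow> c \<le> K \<Longrightarrow> Suc K ^ 2 \<le> min (ell c (f K)) (bms (f K))"
    using exists_separating_string by metis
  have unbounded: "\<exists>w\<in>range f. n \<le> length w" for n
    using len[of n] by (auto intro: less_imp_le)
  have "infinite (range f)"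
  proof
    assume "finite (range f)"
    then obtain n where "\<forall>w\<in>range f. length w < n"
      by (metis finite_imageI finite_nat_set_iff_bounded imageI)
    then show False using unbounded[of n] by (meson leD)
  qed
  then have "string_family (range f)" using unbounded by (simp add: string_family_def)
  moreover have "(\<lambda>w. real (nu w)) \<in> o[along (range f)](\<lambda>w. real (min (ell c w) (bms w)))"
    if c: "c \<ge> 1" for c
  proof (rule landau_o.smallI)
    fix \<epsilon> :: real assume "\<epsilon> > 0"
    obtain K0 where K0: "22 / \<epsilon> \<le> real K0" using real_arch_simple by blast
    \<comment> \<open>Only finitely many indices have \<open>K \<le> max c K0\<close>, so lengths
      beyond theirs force \<open>K\<close> to be larger. Then \<open>c \<le> K\<close>, and the
      ratio \<open>22 / Suc K\<close> is at most \<open>\<epsilon>\<close>.\<close>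
    define n where "n = Suc (Max ((length \<circ> f) ` {..max c K0}))"
    have "real (nu w) \<le> \<epsilon> * real (min (ell c w) (bms w))"
      if w: "w \<in> range f" "n \<le> length w" for w
    proof -
      obtain K where K: "w = f K" using w by blast
      have "max c K0 < K"
      proof (rule ccontr)
        assume "\<not> max c K0 < K"
        then have "(length \<circ> f) K \<le> Max ((length \<circ> f) ` {..max c K0})"
          by (intro Max_ge) auto
        then show False using w(2) K by (simp add: n_def)
      qed
      then have "c \<le> K" "22 / \<epsilon> \<le> real (Suc K)" using K0 by linarith+
      then have "c \<le> K" "22 \<le> \<epsilon> * real (Suc K)"
        using \<open>\<epsilon> > 0\<close> by (simp_all add: field_simps)
      have "real (nu w) \<le> 22 * real (Suc K)"
        using of_nat_mono[OF nu[of K], where 'a = real] K by simp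
      also have "\<dots> \<le> (\<epsilon> * real (Suc K)) * real (Suc K)"
        using \<open>22 \<le> \<epsilon> * real (Suc K)\<close> by (rule mult_right_mono) simp
      also have "\<dots> = \<epsilon> * real (Suc K ^ 2)"
        by (simp only: power2_eq_square of_nat_mult mult.assoc)
      also have "\<epsilon> * real (Suc K ^ 2) \<le> \<epsilon> * real (min (ell c w) (bms w))"
        using big[OF c \<open>c \<le> K\<close>] K \<open>\<epsilon> > 0\<close> by (intro mult_left_mono of_nat_mono) auto
      finally show ?thesis .
    qed
    then show "\<forall>\<^sub>F w in along (range f). norm (real (nu w)) \<le> \<epsilon> * norm (real (min (ell c w) (bms w)))"
      unfolding eventually_along by auto
  qed
  ultimately show ?thesis by blast
qed

end
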